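(* Let $\Omega\subset\mathbb{R}^3$ be a bounded domain and let $p\ge1$ be a real number. For any $k\ge1$ and any connected conforming tetrahedral grid $\mathcal{T}$ of $\Omega$ with more than one element, there is a function $U_h\in V_{h,k}^{\mathrm{sym\,Curl}}$ such that $U_h\notin H(\operatorname{Curl})$.
   Context: $\operatorname{Curl}$ is the classical $\operatorname{curl}$ applied row-wise (distributionally), and $H(\operatorname{Curl}):=\{P\in L^p(\Omega;\mathbb{R}^{3\times3}):\operatorname{Curl}P\in L^p(\Omega;\mathbb{R}^{3\times3})\}$. A domain is a nonempty connected open set. A conforming tetrahedral grid $\mathcal{T}$ of $\Omega$ is a finite set of non-degenerate closed tetrahedra such that $\Omega$ is the interior of their union and any two distinct tetrahedra intersect in the empty set, a common vertex, a common edge or a common face. $\Pi_k(T;\mathbb{R}^{3\times3})$ is the space of $\mathbb{R}^{3\times3}$-valued polynomials of (total) degree $k$ or less on $T$. Lagrange points on $T$ are the points with barycentric coordinates in $\frac1k\mathbb{Z}_{\ge 0}$ with respect to $T$; inner Lagrange points of an edge or face are those in its relative interior. Once and for all for the entire grid the following are fixed: for each face a unit normal $\mathbf{n}$ and two vectors $\mathbf{a}_1,\mathbf{a}_2$ such that $\mathbf{a}_1,\mathbf{a}_2,\mathbf{n}$ are linearly independent; for each edge $E$ a unit tangent $\mathbf{t}_E$ and two unit vectors $\mathbf{n}_{E,1},\mathbf{n}_{E,2}$ spanning the plane orthogonal to $E$. For a face with normal $\mathbf{n}$ containing the edge $E$, set $\boldsymbol{\partial}:=\mathbf{t}_E\times\mathbf{n}$.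 $V_{h,k}^{\mathrm{sym\,Curl}}$ is the set of all $U_h\in L^2(\Omega;\mathbb{R}^{3\times3})$ with $U_h|_T\in\Pi_k(T;\mathbb{R}^{3\times3})$ for all $T\in\mathcal{T}$ such that, writing $U$ for the polynomial $U_h|_T$ evaluated at points of the closed tetrahedron $T$, the following quantities coincide for the elements concerned: - for every vertex $V$, the quantities $U(V)_{ij}$ ($i\ne j$), $U(V)_{11}-U(V)_{22}$ and $U(V)_{22}-U(V)_{33}$ coincide for all elements that share $V$; - for every edge $E$ and every inner Lagrange point $L$ of $E$, the quantities $\mathbf{n}_{E,1}^TU(L)\mathbf{t}_E$ and $\mathbf{n}_{E,2}^TU(L)\mathbf{t}_E$ coincide for all elements that share $E$; and for every face with normal $\mathbf{n}$ containing $E$, the quantities $\mathbf{t}_E^TU(L)(\mathbf{n}\times\mathbf{t}_E)$, $\mathbf{n}^TU(L)(\mathbf{n}\times\mathbf{t}_E)$ and $\mathbf{t}_E^TU(L)(\mathbf{n}\times\boldsymbol{\partial})+\boldsymbol{\partial}^TU(L)(\mathbf{n}\times\mathbf{t}_E)$ coincide for the elements having that face; - for every face $F$ with associated vectors $\mathbf{n},\mathbf{a}_1,\mathbf{a}_2$ and every inner Lagrange point $L$ of $F$, the quantities $\mathbf{a}_1^TU(L)(\mathbf{n}\times\mathbf{a}_1)$, $\mathbf{a}_2^TU(L)(\mathbf{n}\times\mathbf{a}_2)$, $\mathbf{a}_1^TU(L)(\mathbf{n}\times\mathbf{a}_2)+\mathbf{a}_2^TU(L)(\mathbf{n}\times\mathbf{a}_1)$,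 $\mathbf{n}^TU(L)(\mathbf{n}\times\mathbf{a}_1)$ and $\mathbf{n}^TU(L)(\mathbf{n}\times\mathbf{a}_2)$ coincide for the elements that share $F$. (All other local degrees of freedom are unconstrained across elements.) *)

theory Defs
  imports "HOL-Analysis.Analysis"
begin

section \<open>Function spaces and the distributional Curl\<close>

text \<open>Elements of Lebesgue and Sobolev-type spaces on \<open>\<Omega>\<close> are represented by total functions, of
  which only the values almost everywhere in \<open>\<Omega>\<close> matter. On \<open>real^3^3\<close> the norm is the Frobenius
  norm and \<open>P $ i\<close> is the \<open>i\<close>-th row.\<close>

definition Lp_space :: "real \<Rightarrow> (real^3) set \<Rightarrow> (real^3 \<Rightarrow> 'b::euclidean_space) set" where
  "Lp_space p \<Omega> = {f. f \<in> borel_measurable (lebesgue_on \<Omega>) \<and>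
      integrable (lebesgue_on \<Omega>) (\<lambda>x. norm (f x) powr p)}"

text \<open>On a finite-dimensional domain, this is continuity of all partial derivatives up to order \<open>k\<close>.\<close>

primrec C_k :: "nat \<Rightarrow> ('a::euclidean_space \<Rightarrow> 'b::real_normed_vector) \<Rightarrow> bool" where
  "C_k 0 f \<longleftrightarrow> continuous_on UNIV f"
| "C_k (Suc k) f \<longleftrightarrow> (\<forall>x. f differentiable (at x)) \<and>
      (\<forall>v. C_k k (\<lambda>x. frechet_derivative f (at x) v))"

definition test_functions :: "(real^3) set \<Rightarrow> (real^3 \<Rightarrow> real^3) set" where
  "test_functions \<Omega> = {\<phi>. (\<forall>k. C_k k \<phi>) \<and>
      compact (closure {x. \<phi> x \<noteq> 0}) \<and> closure {x. \<phi> x \<noteq> 0} \<subseteq> \<Omega>}"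

definition pderiv3 :: "3 \<Rightarrow> 3 \<Rightarrow> (real^3 \<Rightarrow> real^3) \<Rightarrow> real^3 \<Rightarrow> real" where
  "pderiv3 j i \<phi> x = frechet_derivative \<phi> (at x) (axis j 1) $ i"  \<comment> \<open>\<open>\<partial>\<^sub>j \<phi>\<^sub>i\<close>\<close>

definition curl :: "(real^3 \<Rightarrow> real^3) \<Rightarrow> real^3 \<Rightarrow> real^3" where
  "curl \<phi> x = vector
     [pderiv3 2 3 \<phi> x - pderiv3 3 2 \<phi> x,
      pderiv3 3 1 \<phi> x - pderiv3 1 3 \<phi> x,
      pderiv3 1 2 \<phi> x - pderiv3 2 1 \<phi> x]"

text \<open>\<open>curl\<close> is formally self-adjoint, so no sign appears.\<close>

definition is_weak_Curl ::
    "(real^3) set \<Rightarrow> (real^3 \<Rightarrow> real^3^3) \<Rightarrow> (real^3 \<Rightarrow> real^3^3) \<Rightarrow> bool" where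
  "is_weak_Curl \<Omega> P Q \<longleftrightarrow> (\<forall>i. \<forall>\<phi> \<in> test_functions \<Omega>.
      (LINT x|lebesgue_on \<Omega>. (P x $ i) \<bullet> curl \<phi> x) = (LINT x|lebesgue_on \<Omega>. (Q x $ i) \<bullet> \<phi> x))"

definition H_Curl :: "real \<Rightarrow> (real^3) set \<Rightarrow> (real^3 \<Rightarrow> real^3^3) set" where
  "H_Curl p \<Omega> = {P \<in> Lp_space p \<Omega>. \<exists>Q \<in> Lp_space p \<Omega>. is_weak_Curl \<Omega> P Q}"


section \<open>Tetrahedral grids\<close>

text \<open>The \<open>face_of\<close>-faces of a tetrahedron are the empty set, its vertices (as singletons), edges and
  triangular faces, and the tetrahedron itself; the last cannot be the intersection of two distinct
  members of a triangulation by tetrahedra.\<close>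

definition conforming_tetrahedral_grid :: "(real^3) set set \<Rightarrow> (real^3) set \<Rightarrow> bool" where
  "conforming_tetrahedral_grid \<T> \<Omega> \<longleftrightarrow>
     triangulation \<T> \<and> (\<forall>T\<in>\<T>. 3 simplex T) \<and> \<Omega> = interior (\<Union>\<T>)"

text \<open>The auxiliary vectors fixed for the whole grid, as functions of the face or edge. In
  \<open>grid_frame\<close>, \<open>distinct\<close> makes linear independence that of the triple of vectors
  rather than of the set they form.\<close>

record frame =
  face_normal :: "(real^3) set \<Rightarrow> real^3"
  face_vec1 :: "(real^3) set \<Rightarrow> real^3"
  face_vec2 :: "(real^3) set \<Rightarrow> real^3"
  edge_tangent :: "(real^3) set \<Rightarrow> real^3"
  edge_normal1 :: "(real^3) set \<Rightarrow> real^3"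
  edge_normal2 :: "(real^3) set \<Rightarrow> real^3"

definition grid_frame :: "(real^3) set set \<Rightarrow> frame \<Rightarrow> bool" where
  "grid_frame \<T> \<F> \<longleftrightarrow>
    (\<forall>T\<in>\<T>. \<forall>F. F facet_of T \<longrightarrow>
      (let n = face_normal \<F> F; a1 = face_vec1 \<F> F; a2 = face_vec2 \<F> F in
        norm n = 1 \<and> (\<forall>x\<in>F. \<forall>y\<in>F. orthogonal n (x - y)) \<and>
        distinct [a1, a2, n] \<and> independent {a1, a2, n})) \<and>
    (\<forall>T\<in>\<T>. \<forall>E. E edge_of T \<longrightarrow>
      (let t = edge_tangent \<F> E; n1 = edge_normal1 \<F> E; n2 = edge_normal2 \<F> E in
        norm t = 1 \<and> (\<exists>x\<in>E. \<exists>y\<in>E. \<exists>c. t = c *\<^sub>R (x - y)) \<and>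
        norm n1 = 1 \<and> norm n2 = 1 \<and> span {n1, n2} = {v. orthogonal v t}))"

text \<open>The barycentric coordinates of the point below are \<open>m v / k\<close>.\<close>

definition lagrange_points :: "nat \<Rightarrow> (real^3) set \<Rightarrow> (real^3) set" where
  "lagrange_points k T =
     {\<Sum>v | v extreme_point_of T. (real (m v) / real k) *\<^sub>R v | m :: real^3 \<Rightarrow> nat.
        (\<Sum>v | v extreme_point_of T. m v) = k}"


section \<open>The finite element space\<close>

definition matrix_polys :: "nat \<Rightarrow> (real^3 \<Rightarrow> real^3^3) set" where
  "matrix_polys k =
     {f. \<exists>c :: (3 \<Rightarrow> nat) \<Rightarrow> real^3^3. \<forall>x.
        f x = (\<Sum>\<alpha> | (\<Sum>i\<in>UNIV. \<alpha> i) \<le> k. (\<Prod>i\<in>UNIV. (x $ i) ^ \<alpha> i) *\<^sub>R c \<alpha>)}"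

definition bform :: "real^3 \<Rightarrow> real^3^3 \<Rightarrow> real^3 \<Rightarrow> real" where
  "bform u M v = u \<bullet> (M *v v)"

definition same_at_vertex :: "real^3^3 \<Rightarrow> real^3^3 \<Rightarrow> bool" where
  "same_at_vertex M N \<longleftrightarrow>
     (\<forall>i j. i \<noteq> j \<longrightarrow> M $ i $ j = N $ i $ j) \<and>
     M $ 1 $ 1 - M $ 2 $ 2 = N $ 1 $ 1 - N $ 2 $ 2 \<and>
     M $ 2 $ 2 - M $ 3 $ 3 = N $ 2 $ 2 - N $ 3 $ 3"

definition same_at_edge :: "real^3 \<Rightarrow> real^3 \<Rightarrow> real^3 \<Rightarrow> real^3^3 \<Rightarrow> real^3^3 \<Rightarrow> bool" where
  "same_at_edge t n1 n2 M N \<longleftrightarrow> bform n1 M t = bform n1 N t \<and> bform n2 M t = bform n2 N t"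

definition same_at_edge_in_face :: "real^3 \<Rightarrow> real^3 \<Rightarrow> real^3^3 \<Rightarrow> real^3^3 \<Rightarrow> bool" where
  "same_at_edge_in_face t n M N \<longleftrightarrow>
     (let d = cross3 t n in
       bform t M (cross3 n t) = bform t N (cross3 n t) \<and>
       bform n M (cross3 n t) = bform n N (cross3 n t) \<and>
       bform t M (cross3 n d) + bform d M (cross3 n t) =
         bform t N (cross3 n d) + bform d N (cross3 n t))"

definition same_at_face :: "real^3 \<Rightarrow> real^3 \<Rightarrow> real^3 \<Rightarrow> real^3^3 \<Rightarrow> real^3^3 \<Rightarrow> bool" where
  "same_at_face n a1 a2 M N \<longleftrightarrow>
     bform a1 M (cross3 n a1) = bform a1 N (cross3 n a1) \<and>
     bform a2 M (cross3 n a2) = bform a2 N (cross3 n a2) \<and>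
     bform a1 M (cross3 n a2) + bform a2 M (cross3 n a1) =
       bform a1 N (cross3 n a2) + bform a2 N (cross3 n a1) \<and>
     bform n M (cross3 n a1) = bform n N (cross3 n a1) \<and>
     bform n M (cross3 n a2) = bform n N (cross3 n a2)"

text \<open>\<open>P T\<close> is the polynomial that the finite element function equals on \<open>T\<close>.\<close>

definition symCurl_compatible ::
    "nat \<Rightarrow> (real^3) set set \<Rightarrow> frame \<Rightarrow> ((real^3) set \<Rightarrow> real^3 \<Rightarrow> real^3^3) \<Rightarrow> bool" where
  "symCurl_compatible k \<T> \<F> P \<longleftrightarrow> (\<forall>S\<in>\<T>. \<forall>T\<in>\<T>.
     (\<forall>v. v extreme_point_of S \<and> v extreme_point_of T \<longrightarrow> same_at_vertex (P S v) (P T v)) \<and>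
     (\<forall>E. E edge_of S \<and> E edge_of T \<longrightarrow> (\<forall>l \<in> lagrange_points k S \<inter> rel_interior E.
        same_at_edge (edge_tangent \<F> E) (edge_normal1 \<F> E) (edge_normal2 \<F> E) (P S l) (P T l) \<and>
        (\<forall>F. F facet_of S \<and> F facet_of T \<and> E \<subseteq> F \<longrightarrow>
           same_at_edge_in_face (edge_tangent \<F> E) (face_normal \<F> F) (P S l) (P T l)))) \<and>
     (\<forall>F. F facet_of S \<and> F facet_of T \<longrightarrow> (\<forall>l \<in> lagrange_points k S \<inter> rel_interior F.
        same_at_face (face_normal \<F> F) (face_vec1 \<F> F) (face_vec2 \<F> F) (P S l) (P T l))))"

definition V_symCurl ::
    "nat \<Rightarrow> (real^3) set set \<Rightarrow> frame \<Rightarrow> (real^3) set \<Rightarrow> (real^3 \<Rightarrow> real^3^3) set" where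
  "V_symCurl k \<T> \<F> \<Omega> = {U \<in> Lp_space 2 \<Omega>. \<exists>P.
     (\<forall>T\<in>\<T>. P T \<in> matrix_polys k \<and> (AE x in lebesgue_on T. U x = P T x)) \<and>
     symCurl_compatible k \<T> \<F> P}"

end

theory Submission
  imports Defs
begin

text \<open>The interelement conditions control only the symmetric Curl, and the symmetric Curl does not
  see multiples of the identity: \<open>Curl (f I)\<close> is the skew-symmetric matrix associated with \<open>\<nabla>f\<close>,
  however rough \<open>f\<close> is. Accordingly all interelement quantities vanish on multiples of the identity
  (\<open>scaled_identities_compatible\<close>). So \<open>f I\<close> with \<open>f\<close> the indicator of a single element \<open>T\<close> belongs
  to the finite element space for every degree (\<open>grid_element_indicator_in_V_symCurl\<close>).

  The Curl of this function is not in \<open>L\<^sup>p\<close>, because its entries are the partial derivatives of \<open>f\<close>,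
  and these are measures concentrated on the faces of \<open>T\<close>. The argument avoids surface integrals.
  Suppose that \<open>f\<close> has an integrable weak gradient in \<open>\<Omega>\<close>. It is zero off the planes that
  bound \<open>T\<close>, and these planes form a null set, so it is zero; precisely,
  \<open>\<integral>\<^sub>T \<partial>\<^sub>v \<psi> = 0\<close> for every test function \<open>\<psi>\<close> (\<open>polyhedron_weak_derivative_eq_0\<close>). But a bump
  centred just outside \<open>T\<close>, near a point where the frontier of \<open>T\<close> enters \<open>\<Omega>\<close>, has, at all points of \<open>T\<close>,
  a nonnegative derivative in the direction that separates its centre from \<open>T\<close>, so that
  \<open>\<integral>\<^sub>T \<partial>\<^sub>v \<psi> > 0\<close> (\<open>convex_frontier_detected_by_test_function\<close>). Such a point exists since \<open>\<Omega>\<close> is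
  connected and \<open>T\<close> is not the only element (\<open>grid_element_frontier_meets_domain\<close>).\<close>

section \<open>Calculus of smooth functions\<close>

text \<open>Iterated differentiability is established by computing one derivative at a time: a class of
  functions whose derivatives again lie in the class is smooth, so each closure property below
  is an induction on the order.\<close>

lemma C_k_SucI:
  assumes "\<And>x. (f has_derivative f' x) (at x)" and "\<And>v. C_k k (\<lambda>x. f' x v)"
  shows "C_k (Suc k) f"
proof -
  have "frechet_derivative f (at x) = f' x" for x
    using frechet_derivative_at[OF assms(1)] by simp
  then show ?thesis
    using assms by (auto simp: differentiable_def)
qed

lemma C_k_Suc_has_derivative:
  "C_k (Suc k) f \<Longrightarrow> (f has_derivative frechet_derivative f (at x)) (at x)"
  by (simp add: frechet_derivative_works)

lemma C_k_antimono:
  assumes "C_k (Suc k) f"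
  shows "C_k k f"
  using assms
proof (induction k arbitrary: f)
  case 0
  then show ?case
    by (auto simp: continuous_on_eq_continuous_at differentiable_imp_continuous_within)
next
  case (Suc k)
  then show ?case by (metis C_k.simps(2))
qed

lemma C_k_continuous: "C_k k f \<Longrightarrow> continuous_on UNIV f"
  by (induction k) (auto dest: C_k_antimono simp del: C_k.simps(2))

lemma C_k_const: "C_k k (\<lambda>x. c)"
  by (induction k arbitrary: c) (auto intro!: C_k_SucI[where f'="\<lambda>x v. 0"] simp del: C_k.simps(2))

lemma C_k_bounded_linear:
  assumes "bounded_linear f"
  shows "C_k k f"
proof (cases k)
  case 0
  then show ?thesis using assms by (simp add: linear_continuous_on)
next
  case (Suc j)
  then show ?thesis
    using C_k_SucI[of f "\<lambda>x. f" j] C_k_const bounded_linear_imp_has_derivative[OF assms] by blast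
qed

lemma C_k_add:
  assumes "C_k k f" and "C_k k g"
  shows "C_k k (\<lambda>x. f x + g x)"
  using assms
proof (induction k arbitrary: f g)
  case 0
  then show ?case by (simp add: continuous_on_add)
next
  case (Suc k)
  show ?case
    by (rule C_k_SucI[OF has_derivative_add[OF Suc.prems[THEN C_k_Suc_has_derivative]]])
      (use Suc in auto)
qed

lemma C_k_scaleR:
  fixes f :: "'a::euclidean_space \<Rightarrow> real"
  assumes "C_k k f" and "C_k k g"
  shows "C_k k (\<lambda>x. f x *\<^sub>R g x)"
  using assms
proof (induction k arbitrary: f g)
  case 0
  then show ?case by (simp add: continuous_on_scaleR)
next
  case (Suc k)
  show ?case
    by (rule C_k_SucI[OF has_derivative_scaleR[OF Suc.prems[THEN C_k_Suc_has_derivative]]])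
      (use Suc.prems in \<open>auto intro!: C_k_add Suc.IH C_k_antimono[of k f] C_k_antimono[of k g]\<close>)
qed

lemmas C_k_mult = C_k_scaleR[where 'b=real, unfolded real_scaleR_def]

lemma C_k_prod:
  fixes f :: "'i \<Rightarrow> 'a::euclidean_space \<Rightarrow> real"
  assumes "\<And>i. i \<in> I \<Longrightarrow> C_k k (f i)"
  shows "C_k k (\<lambda>x. \<Prod>i\<in>I. f i x)"
  using assms by (induction I rule: infinite_finite_induct) (auto intro!: C_k_const C_k_mult)

lemma C_k_compose_real:
  fixes f :: "real \<Rightarrow> 'b::real_normed_vector" and g :: "'a::euclidean_space \<Rightarrow> real"
  assumes "C_k k f" and "C_k k g"
  shows "C_k k (\<lambda>x. f (g x))"
  using assms
proof (induction k arbitrary: f g)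
  case 0
  then show ?case by (auto intro: continuous_on_compose2)
next
  case (Suc k)
  have d: "((\<lambda>x. f (g x)) has_derivative
      (\<lambda>v. frechet_derivative g (at x) v *\<^sub>R frechet_derivative f (at (g x)) 1)) (at x)" for x
  proof -
    note F = C_k_Suc_has_derivative[OF Suc.prems(1), of "g x"]
    define c where "c = frechet_derivative f (at (g x)) 1"
    have "frechet_derivative f (at (g x)) r = r *\<^sub>R c" for r
      using linear_scale[OF has_derivative_linear[OF F], of r 1]
      unfolding real_scaleR_def mult_1_right c_def .
    then have "frechet_derivative f (at (g x)) = (\<lambda>r. r *\<^sub>R c)"
      by (rule ext)
    from has_derivative_compose[OF C_k_Suc_has_derivative[OF Suc.prems(2)] F[unfolded this]]
    show ?thesis
      unfolding c_def .
  qed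
  show ?case
    by (rule C_k_SucI[OF d], rule C_k_scaleR)
      (use Suc.prems in \<open>auto intro!: Suc.IH C_k_antimono[of k g]\<close>)
qed

section \<open>A smooth function that is flat at the origin\<close>

text \<open>Cutoffs and bumps are built from \<open>t \<mapsto> exp (-1/t)\<close>, extended by \<open>0\<close>. Its derivatives are
  polynomials in \<open>1/t\<close> times the same exponential; carrying the polynomial \<open>p\<close> as a parameter
  makes the family closed under differentiation, so that smoothness is a plain induction.\<close>

definition flat_exp :: "real poly \<Rightarrow> real \<Rightarrow> real" where
  "flat_exp p t = (if t > 0 then poly p (1/t) * exp (- (1/t)) else 0)"

lemma poly_times_exp_minus_tendsto_0: "((\<lambda>x. poly p x * exp (- x)) \<longlongrightarrow> (0::real)) at_top"
proof -
  have "((\<lambda>x. \<Sum>i\<le>degree p. coeff p i * (x ^ i / exp x)) \<longlongrightarrow> (\<Sum>i\<le>degree p. coeff p i * 0)) at_top"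
    by (intro tendsto_intros tendsto_power_div_exp_0)
  then show ?thesis
    by (simp add: poly_altdef sum_distrib_right exp_minus divide_inverse mult.assoc)
qed

text \<open>With \<open>u = 1/t\<close> the derivative of \<open>p(u) exp(-u)\<close> is \<open>u\<^sup>2 (p(u) - p'(u)) exp(-u)\<close>. At the origin the
  difference quotient is \<open>u p(u) exp(-u)\<close>, which decays because the exponential beats every polynomial.\<close>

lemma flat_exp_has_derivative:
  "(flat_exp p has_real_derivative flat_exp ([:0,0,1:] * (p - pderiv p)) t) (at t)"
proof (rule linorder_cases[of t 0])
  assume "t > 0"
  have "((\<lambda>t. poly p (1/t) * exp (- (1/t))) has_real_derivative
      flat_exp ([:0,0,1:] * (p - pderiv p)) t) (at t)"
    using \<open>t > 0\<close> unfolding flat_exp_def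
    by (auto intro!: derivative_eq_intros DERIV_chain2[OF poly_DERIV]
        simp: power2_eq_square field_simps)
  then show ?thesis
    by (rule DERIV_cong_ev[THEN iffD1, OF refl _ refl, rotated])
      (use \<open>t > 0\<close> eventually_nhds_in_open[of "{0<..}" t] in
        \<open>auto simp: flat_exp_def elim!: eventually_mono\<close>)
next
  assume "t < 0"
  have "((\<lambda>t. 0) has_real_derivative flat_exp ([:0,0,1:] * (p - pderiv p)) t) (at t)"
    using \<open>t < 0\<close> by (simp add: flat_exp_def)
  then show ?thesis
    by (rule DERIV_cong_ev[THEN iffD1, OF refl _ refl, rotated])
      (use \<open>t < 0\<close> eventually_nhds_in_open[of "{..<0}" t] in
        \<open>auto simp: flat_exp_def elim!: eventually_mono\<close>)
next
  assume [simp]: "t = 0"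
  have "((\<lambda>h. flat_exp p h / h) \<longlongrightarrow> 0) (at_left 0)"
    by (rule Lim_transform_eventually[OF tendsto_const])
      (auto simp: flat_exp_def eventually_at_filter)
  moreover have "((\<lambda>h. flat_exp p h / h) \<longlongrightarrow> 0) (at_right 0)"
  proof -
    have "((\<lambda>h::real. poly (pCons 0 p) (inverse h) * exp (- (inverse h))) \<longlongrightarrow> 0) (at_right 0)"
      by (rule filterlim_compose[OF poly_times_exp_minus_tendsto_0 filterlim_inverse_at_top_right])
    then show ?thesis
      by (rule Lim_transform_eventually)
        (auto simp: flat_exp_def eventually_at_filter field_simps)
  qed
  ultimately have "((\<lambda>h. flat_exp p h / h) \<longlongrightarrow> 0) (at 0)"
    by (rule filterlim_split_at)
  then show ?thesis
    by (simp add: has_field_derivative_iff flat_exp_def)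
qed

lemma C_k_flat_exp: "C_k k (flat_exp p)"
proof (induction k arbitrary: p)
  case 0
  then show ?case
    using flat_exp_has_derivative by (auto intro!: DERIV_continuous_on)
next
  case (Suc k)
  show ?case
    by (rule C_k_SucI[OF flat_exp_has_derivative[unfolded has_field_derivative_def]])
      (intro C_k_mult Suc.IH C_k_const)
qed

section \<open>Integrals of derivatives of compactly supported functions\<close>

lemma has_real_derivative_along_line:
  fixes w :: "'a::euclidean_space \<Rightarrow> real"
  assumes "C_k (Suc k) w"
  shows "((\<lambda>s. w (x + s *\<^sub>R v)) has_real_derivative frechet_derivative w (at (x + s *\<^sub>R v)) v) (at s)"
proof -
  note w = C_k_Suc_has_derivative[OF assms, of "x + s *\<^sub>R v"]
  have "((\<lambda>s. x + s *\<^sub>R v) has_derivative (\<lambda>h. h *\<^sub>R v)) (at s)"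
    by (auto intro!: derivative_eq_intros)
  from has_derivative_compose[OF this w]
  have "((\<lambda>s. w (x + s *\<^sub>R v)) has_derivative (\<lambda>h. frechet_derivative w (at (x + s *\<^sub>R v)) (h *\<^sub>R v))) (at s)" .
  moreover have "(\<lambda>h. frechet_derivative w (at (x + s *\<^sub>R v)) (h *\<^sub>R v)) = (*) (frechet_derivative w (at (x + s *\<^sub>R v)) v)"
    by (rule ext, subst linear_scale[OF has_derivative_linear[OF w]]) simp
  ultimately show ?thesis
    unfolding has_field_derivative_def by metis
qed

lemma frechet_derivative_eq_on_open:
  assumes "open U" and "x \<in> U" and "\<And>y. y \<in> U \<Longrightarrow> f y = g y" and "g differentiable (at x)"
  shows "frechet_derivative f (at x) = frechet_derivative g (at x)"
proof -
  have "(f has_derivative frechet_derivative g (at x)) (at x)"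
    by (rule has_derivative_transform_within_open[OF _ assms(1,2)])
      (use assms frechet_derivative_works in auto)
  from frechet_derivative_at[OF this, symmetric] show ?thesis .
qed

lemma frechet_derivative_eq_0_on_open:
  assumes "open U" and "x \<in> U" and "\<And>y. y \<in> U \<Longrightarrow> f y = 0"
  shows "frechet_derivative f (at x) v = 0"
  using frechet_derivative_eq_on_open[OF assms(1,2), of f "\<lambda>_. 0"] assms(3)
  by (simp add: frechet_derivative_const)

lemma continuous_compact_support_integrable:
  fixes f :: "'a::euclidean_space \<Rightarrow> real"
  assumes "continuous_on UNIV f" and "compact K" and "\<And>x. x \<notin> K \<Longrightarrow> f x = 0"
  shows "integrable lborel f"
proof -
  have "integrable lborel (\<lambda>x. indicator K x *\<^sub>R f x)"
    using assms by (intro borel_integrable_compact) (auto intro: continuous_on_subset)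
  also have "(\<lambda>x. indicator K x *\<^sub>R f x) = f"
    using assms(3) by (auto simp: indicator_def fun_eq_iff)
  finally show ?thesis .
qed

lemma continuous_compact_support_bounded:
  fixes f :: "'a::euclidean_space \<Rightarrow> real"
  assumes "continuous_on UNIV f" and "compact K" and "\<And>x. x \<notin> K \<Longrightarrow> f x = 0"
  obtains B where "\<And>x. \<bar>f x\<bar> \<le> B" and "B \<ge> 0"
proof -
  have "bounded (f ` K)"
    using assms by (intro compact_imp_bounded compact_continuous_image) (auto intro: continuous_on_subset)
  then obtain B where B: "\<forall>y\<in>f ` K. norm y \<le> B" "B > 0"
    using bounded_pos by blast
  have "\<bar>f x\<bar> \<le> B" for x
    using B assms(3)[of x] by (cases "x \<in> K") auto
  with B that show thesis by (meson less_imp_le)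
qed

text \<open>The integral of a difference quotient \<open>(w (x + h v) - w x) / h\<close> vanishes by translation invariance
  of Lebesgue measure. The mean value theorem bounds these quotients uniformly, on a fixed ball
  containing all the shifted supports, so the limit \<open>h \<rightarrow> 0\<close> may be taken under the integral.\<close>

lemma integral_directional_derivative_eq_0:
  fixes w :: "'a::euclidean_space \<Rightarrow> real"
  assumes C: "C_k (Suc k) w" and K: "compact K" and supp: "\<And>x. x \<notin> K \<Longrightarrow> w x = 0"
  shows "(LINT x|lborel. frechet_derivative w (at x) v) = 0"
proof -
  define D where "D x = frechet_derivative w (at x) v" for x
  define h where "h n = 1 / real (Suc n)" for n
  define s where "s n x = (w (x + h n *\<^sub>R v) - w x) / h n" for n x
  have h: "0 < h n" "h n \<le> 1" for n
    by (auto simp: h_def)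
  have h0: "h \<longlonglongrightarrow> 0"
    unfolding h_def using LIMSEQ_inverse_real_of_nat by (simp add: inverse_eq_divide)
  have contw: "continuous_on UNIV w"
    by (rule C_k_continuous[OF C])
  have contD: "continuous_on UNIV D"
    using C C_k_continuous unfolding D_def by auto
  have suppD: "D x = 0" if "x \<notin> K" for x
    unfolding D_def using that K supp
    by (intro frechet_derivative_eq_0_on_open[of "- K"]) (auto simp: compact_imp_closed)
  obtain B where B: "\<And>x. \<bar>D x\<bar> \<le> B" "B \<ge> 0"
    using continuous_compact_support_bounded[OF contD K suppD] by blast
  obtain R where R: "\<And>x. x \<in> K \<Longrightarrow> norm x \<le> R"
    using compact_imp_bounded[OF K] unfolding bounded_iff by blast
  have bound: "\<bar>s n x\<bar> \<le> B * indicator (cball 0 (R + norm v)) x" for n x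
  proof (cases "x \<in> cball 0 (R + norm v)")
    case True
    obtain z where z: "w (x + h n *\<^sub>R v) - w (x + 0 *\<^sub>R v) = (h n - 0) * D (x + z *\<^sub>R v)"
      using MVT2[OF h(1)[of n], where f="\<lambda>s. w (x + s *\<^sub>R v)" and f'="\<lambda>s. D (x + s *\<^sub>R v)"]
        has_real_derivative_along_line[OF C] unfolding D_def by blast
    then have "s n x = D (x + z *\<^sub>R v)"
      using h(1)[of n] by (simp add: s_def)
    then show ?thesis
      using True B by simp
  next
    case False
    have "norm (x + h n *\<^sub>R v) \<ge> norm x - norm (h n *\<^sub>R v)"
      by (rule norm_diff_ineq)
    moreover have "norm (h n *\<^sub>R v) \<le> norm v"
      using h[of n] by (simp add: mult_left_le_one_le)
    ultimately have "norm (x + h n *\<^sub>R v) > R"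
      using False by simp
    moreover have "norm x > R"
      using False norm_ge_zero[of v] unfolding mem_cball_0 by linarith
    ultimately have "x \<notin> K" "x + h n *\<^sub>R v \<notin> K"
      using R not_le by blast+
    then show ?thesis
      using False by (simp add: s_def supp)
  qed
  have lim: "(\<lambda>n. s n x) \<longlonglongrightarrow> D x" for x
  proof -
    have "((\<lambda>s. (w (x + s *\<^sub>R v) - w x) / s) \<longlongrightarrow> D x) (at 0)"
      using has_real_derivative_along_line[OF C, of x v 0]
      by (simp add: has_field_derivative_iff D_def)
    moreover have "filterlim h (at 0) sequentially"
      using h0 h(1) by (auto simp: filterlim_at less_imp_neq[symmetric])
    ultimately show ?thesis
      unfolding s_def by (rule filterlim_compose)
  qed
  have int0: "integral\<^sup>L lborel (s n) = 0" for n
  proof -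
    have i: "integrable lborel w"
      by (rule continuous_compact_support_integrable[OF contw K supp])
    have m: "w \<in> borel_measurable borel"
      using contw by (rule borel_measurable_continuous_onI)
    have d: "lborel = distr lborel borel ((+) (h n *\<^sub>R v))"
      by (simp add: lborel_distr_plus)
    have "integrable lborel (\<lambda>x. w (h n *\<^sub>R v + x))"
      using i m by (subst (asm) d, subst (asm) integrable_distr_eq) auto
    moreover have "(LINT x|lborel. w x) = (LINT x|lborel. w (h n *\<^sub>R v + x))"
      using m by (subst d, subst integral_distr) auto
    ultimately show ?thesis
      using i unfolding s_def by (simp add: add.commute)
  qed
  have "(\<lambda>n. integral\<^sup>L lborel (s n)) \<longlonglongrightarrow> integral\<^sup>L lborel D"
  proof (rule integral_dominated_convergence)
    show "D \<in> borel_measurable lborel"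
      using contD by (simp add: borel_measurable_continuous_onI)
    show "s n \<in> borel_measurable lborel" for n
      unfolding s_def using h(1)[of n]
      by (auto intro!: borel_measurable_continuous_onI continuous_intros
          continuous_on_compose2[OF contw] continuous_on_subset[OF contw])
    show "integrable lborel (\<lambda>x. B * indicator (cball 0 (R + norm v)) x)"
      by (intro integrable_mult_right integrable_real_indicator)
        (use emeasure_bounded_finite[OF bounded_cball] in \<open>auto simp: less_top\<close>)
    show "AE x in lborel. norm (s n x) \<le> B * indicator (cball 0 (R + norm v)) x" for n
      using bound by simp
  qed (use lim in simp)
  then have "integral\<^sup>L lborel D = 0"
    unfolding int0 by (rule LIMSEQ_unique) (rule tendsto_const)
  then show ?thesis
    unfolding D_def .
qed

text \<open>Every component of a vector-valued test function is of this kind, and only fields of the form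
  \<open>\<psi> e\<close> with a fixed vector \<open>e\<close> are needed to detect a weak derivative.\<close>

definition scalar_test_functions :: "'a::euclidean_space set \<Rightarrow> ('a \<Rightarrow> real) set" where
  "scalar_test_functions \<Omega> = {\<psi>. (\<forall>k. C_k k \<psi>) \<and>
      compact (closure {x. \<psi> x \<noteq> 0}) \<and> closure {x. \<psi> x \<noteq> 0} \<subseteq> \<Omega>}"

lemma scalar_test_functionE:
  assumes "\<psi> \<in> scalar_test_functions \<Omega>"
  obtains K where "compact K" and "K \<subseteq> \<Omega>" and "\<And>x. x \<notin> K \<Longrightarrow> \<psi> x = 0"
    and "\<And>x v. x \<notin> K \<Longrightarrow> frechet_derivative \<psi> (at x) v = 0"
proof
  let ?K = "closure {x. \<psi> x \<noteq> 0}"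
  show "compact ?K" "?K \<subseteq> \<Omega>"
    using assms unfolding scalar_test_functions_def by blast+
  show 0: "\<psi> x = 0" if "x \<notin> ?K" for x
    using that closure_subset[of "{x. \<psi> x \<noteq> 0}"] by blast
  show "frechet_derivative \<psi> (at x) v = 0" if "x \<notin> ?K" for x v
  proof (rule frechet_derivative_eq_0_on_open)
    show "open (- ?K)" and "x \<in> - ?K"
      using that by (simp_all add: open_Compl)
    show "\<psi> y = 0" if "y \<in> - ?K" for y
      using that by (intro 0) simp
  qed
qed

lemma scalar_test_function_mult:
  assumes "\<psi> \<in> scalar_test_functions \<Omega>" and "\<And>k. C_k k \<eta>"
  shows "(\<lambda>x. \<psi> x * \<eta> x) \<in> scalar_test_functions \<Omega>"
proof -
  have "closure {x. \<psi> x * \<eta> x \<noteq> 0} \<subseteq> closure {x. \<psi> x \<noteq> 0}"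
    by (rule closure_mono) auto
  then show ?thesis
    using assms bounded_subset
    by (auto simp: scalar_test_functions_def compact_eq_bounded_closed intro!: C_k_mult)
qed

lemma scalar_test_function_derivative_continuous:
  assumes "\<psi> \<in> scalar_test_functions \<Omega>"
  shows "continuous_on UNIV (\<lambda>x. frechet_derivative \<psi> (at x) v)"
proof -
  have "C_k (Suc 0) \<psi>"
    using assms unfolding scalar_test_functions_def by blast
  then show ?thesis
    by simp
qed

lemma lebesgue_on_integral_eq_lborel:
  fixes f :: "'a::euclidean_space \<Rightarrow> real"
  assumes "open \<Omega>" and "f \<in> borel_measurable borel" and "\<And>x. x \<notin> \<Omega> \<Longrightarrow> f x = 0"
  shows "(LINT x|lebesgue_on \<Omega>. f x) = (LINT x|lborel. f x)"
proof -
  have "(LINT x|lebesgue_on \<Omega>. f x) = (LINT x|lebesgue. indicator \<Omega> x *\<^sub>R f x)"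
    using assms(1) by (subst integral_restrict_space) auto
  also have "(\<lambda>x. indicator \<Omega> x *\<^sub>R f x) = f"
    using assms(3) by (auto simp: indicator_def fun_eq_iff)
  also have "(LINT x|lebesgue. f x) = (LINT x|lborel. f x)"
    using assms(2) by (intro integral_completion) simp
  finally show ?thesis .
qed

section \<open>Weak derivatives of the indicator of a polyhedron\<close>

lemma flat_exp_1_nonneg: "0 \<le> flat_exp 1 t"
  and flat_exp_1_le_1: "flat_exp 1 t \<le> 1"
  and flat_exp_1_eq_0: "t \<le> 0 \<Longrightarrow> flat_exp 1 t = 0"
  by (auto simp: flat_exp_def)

lemma flat_exp_1_tendsto_1: "(flat_exp 1 \<longlongrightarrow> 1) at_top"
proof -
  have "((\<lambda>t::real. exp (- inverse t)) \<longlongrightarrow> exp (- 0)) at_top"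
    by (intro tendsto_intros tendsto_inverse_0_at_top filterlim_ident)
  then have "((\<lambda>t::real. exp (- inverse t)) \<longlongrightarrow> 1) at_top"
    by simp
  moreover have "\<forall>\<^sub>F t in at_top. exp (- inverse t) = flat_exp 1 t"
    using eventually_gt_at_top[of 0] by eventually_elim (simp add: flat_exp_def inverse_eq_divide)
  ultimately show ?thesis
    by (rule Lim_transform_eventually)
qed

text \<open>A smooth cutoff that vanishes for \<open>\<bar>s\<bar> \<le> 1/n\<close> and tends to \<open>1\<close> away from the origin. Applied to the
  affine functions that define the halfspaces of a polyhedron, it removes the bounding planes from the support of
  a test function at vanishing cost. At most one of the two summands is nonzero.\<close>

definition avoid_zero :: "nat \<Rightarrow> real \<Rightarrow> real" where
  "avoid_zero n s = flat_exp 1 (real n * s - 1) + flat_exp 1 (real n * (- s) - 1)"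

lemma C_k_affine_real: "C_k k (\<lambda>s::real. a * s - b)"
proof -
  have "C_k k (\<lambda>s::real. a * s + (- b))"
    by (intro C_k_add C_k_const C_k_bounded_linear bounded_linear_mult_right)
  then show ?thesis by simp
qed

lemma C_k_flat_exp_affine: "C_k k (\<lambda>s. flat_exp p (a * s - b))"
  by (rule C_k_compose_real[OF C_k_flat_exp C_k_affine_real])

lemma C_k_avoid_zero: "C_k k (avoid_zero n)"
proof -
  have "avoid_zero n = (\<lambda>s. flat_exp 1 (real n * s - 1) + flat_exp 1 ((- real n) * s - 1))"
    by (simp add: avoid_zero_def fun_eq_iff)
  then show ?thesis
    using C_k_add[OF C_k_flat_exp_affine C_k_flat_exp_affine] by metis
qed

lemma avoid_zero_bounds: "0 \<le> avoid_zero n s" "avoid_zero n s \<le> 1"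
proof -
  have "real n * s - 1 \<le> 0 \<or> real n * (- s) - 1 \<le> 0"
    by auto
  then show "0 \<le> avoid_zero n s" "avoid_zero n s \<le> 1"
    unfolding avoid_zero_def
    using flat_exp_1_nonneg flat_exp_1_le_1 by (auto simp: flat_exp_1_eq_0)
qed

lemma avoid_zero_tendsto_1:
  assumes "s \<noteq> 0"
  shows "(\<lambda>n. avoid_zero n s) \<longlonglongrightarrow> 1"
proof -
  have pos: "(\<lambda>n. avoid_zero n s) \<longlonglongrightarrow> 1" if "s > 0" for s
  proof -
    have "filterlim (\<lambda>n. (- 1) + real n * s) at_top sequentially"
      using \<open>s > 0\<close>
      by (intro filterlim_tendsto_add_at_top[OF tendsto_const]
          filterlim_at_top_mult_tendsto_pos[OF tendsto_const _ filterlim_real_sequentially])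
    from filterlim_compose[OF flat_exp_1_tendsto_1 this]
    have "(\<lambda>n. flat_exp 1 (real n * s - 1)) \<longlonglongrightarrow> 1"
      by simp
    moreover have "flat_exp 1 (real n * (- s) - 1) = 0" for n
    proof (rule flat_exp_1_eq_0)
      have "0 \<le> real n * s"
        using \<open>s > 0\<close> by simp
      then show "real n * (- s) - 1 \<le> 0"
        unfolding mult_minus_right by linarith
    qed
    ultimately show ?thesis
      by (simp add: avoid_zero_def)
  qed
  have "avoid_zero n (- s) = avoid_zero n s" for n
    by (simp add: avoid_zero_def)
  then show ?thesis
    using pos[of s] pos[of "- s"] assms by (cases "s > 0") auto
qed

lemma polyhedron_halfspaces:
  fixes S :: "'a::euclidean_space set"
  assumes "polyhedron S"
  shows "\<exists>(F :: 'a set set) a b. finite F \<and> (\<forall>h\<in>F. a h \<noteq> 0) \<and> S = {x. \<forall>h\<in>F. a h \<bullet> x \<le> b h}"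
proof -
  obtain F where F: "finite F" "S = \<Inter>F" "\<forall>h\<in>F. \<exists>a b. a \<noteq> 0 \<and> h = {x. a \<bullet> x \<le> b}"
    using assms unfolding polyhedron_def by blast
  then obtain a b where ab: "\<And>h. h \<in> F \<Longrightarrow> a h \<noteq> 0 \<and> h = {x. a h \<bullet> x \<le> b h}"
    by metis
  have "x \<in> h \<longleftrightarrow> a h \<bullet> x \<le> b h" if "h \<in> F" for x h
    using ab[OF that] by blast
  then have "S = {x. \<forall>h\<in>F. a h \<bullet> x \<le> b h}"
    unfolding F(2) by blast
  moreover have "\<forall>h\<in>F. a h \<noteq> 0"
    using ab by simp
  ultimately show ?thesis
    using F(1) by (intro exI conjI)
qed

text \<open>If the indicator of a polyhedron has an integrable weak directional derivative \<open>g\<close>, then \<open>g\<close>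
  is zero as a distribution: a test function supported off the facet planes does not see the jump of the indicator,
  so \<open>\<integral> g w = 0\<close> for such \<open>w\<close>. The facet planes form a null set, and integrability of \<open>g\<close> lets
  an arbitrary \<open>\<psi>\<close> be approximated by such \<open>w\<close> under the integral. The surface measure that is
  the true derivative charges these planes, so it fails exactly this approximation.\<close>

lemma polyhedron_weak_derivative_eq_0:
  fixes S \<Omega> :: "'a::euclidean_space set"
  assumes S: "polyhedron S" and \<Omega>: "open \<Omega>" and g: "integrable (lebesgue_on \<Omega>) g"
    and weak: "\<And>\<psi>. \<psi> \<in> scalar_test_functions \<Omega> \<Longrightarrow>
      (LINT x|lebesgue_on \<Omega>. indicator S x * frechet_derivative \<psi> (at x) v) =
      (LINT x|lebesgue_on \<Omega>. g x * \<psi> x)"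
    and \<psi>: "\<psi> \<in> scalar_test_functions \<Omega>"
  shows "(LINT x|lebesgue_on \<Omega>. indicator S x * frechet_derivative \<psi> (at x) v) = 0"
proof -
  from polyhedron_halfspaces[OF S] obtain F :: "'a set set" and a b
    where F: "finite F" "\<forall>h\<in>F. a h \<noteq> 0" and S_eq: "S = {x. \<forall>h\<in>F. a h \<bullet> x \<le> b h}"
    by blast
  have "closed S"
    using S by (rule polyhedron_imp_closed)
  define t where "t h x = b h - a h \<bullet> x" for h x
  have C_t: "C_k k (t h)" for k h
  proof -
    have "C_k k (\<lambda>x. b h + (- a h) \<bullet> x)"
      by (intro C_k_add C_k_const C_k_bounded_linear bounded_linear_inner_right)
    then show ?thesis by (simp add: t_def[abs_def])
  qed
  define w where "w n x = \<psi> x * (\<Prod>h\<in>F. avoid_zero n (t h x))" for n x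
  define u where "u n x = \<psi> x * (\<Prod>h\<in>F. flat_exp 1 (real n * t h x - 1))" for n x
  have w: "w n \<in> scalar_test_functions \<Omega>" for n
    unfolding w_def[abs_def]
    by (intro scalar_test_function_mult \<psi> C_k_prod C_k_compose_real[OF C_k_avoid_zero C_t])
  have u: "u n \<in> scalar_test_functions \<Omega>" for n
    unfolding u_def[abs_def]
    by (intro scalar_test_function_mult \<psi> C_k_prod C_k_compose_real[OF C_k_flat_exp_affine C_t])
  \<comment> \<open>The cut-off test function \<open>w n\<close> splits into a part \<open>u n\<close> supported inside \<open>S\<close> and parts supported
    outside; multiplying by the indicator retains just the former, which is again smooth.\<close>
  have indicator_w: "indicator S x * frechet_derivative (w n) (at x) v = frechet_derivative (u n) (at x) v" for n x
  proof (cases "x \<in> S")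
    case True
    \<comment> \<open>A neighbourhood of \<open>S\<close> on which the outer summand of every cutoff factor is still zero.\<close>
    define U where "U = (\<Inter>h\<in>F. {x. real n * (- t h x) < 1})"
    have "open U"
      unfolding U_def t_def
      by (intro open_INT ballI F(1) open_Collect_less continuous_intros)
    moreover have "x \<in> U"
    proof -
      have "real n * (- t h x) < 1" if "h \<in> F" for h
      proof -
        have "0 \<le> t h x"
          using True that unfolding S_eq t_def by simp
        then have "0 \<le> real n * t h x"
          by simp
        then show ?thesis
          unfolding mult_minus_right by linarith
      qed
      then show ?thesis
        by (simp add: U_def)
    qed
    moreover have "w n y = u n y" if "y \<in> U" for y
    proof -
      have "avoid_zero n (t h y) = flat_exp 1 (real n * t h y - 1)" if "h \<in> F" for h
      proof -
        have "real n * (- t h y) < 1"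
          using \<open>y \<in> U\<close> that unfolding U_def by blast
        then have "flat_exp 1 (real n * (- t h y) - 1) = 0"
          by (intro flat_exp_1_eq_0) linarith
        then show ?thesis
          unfolding avoid_zero_def by linarith
      qed
      then show ?thesis
        unfolding w_def u_def by (simp cong: prod.cong)
    qed
    moreover have "u n differentiable (at x)"
    proof -
      have "C_k (Suc 0) (u n)"
        using u[of n] unfolding scalar_test_functions_def by blast
      then show ?thesis by simp
    qed
    ultimately have "frechet_derivative (w n) (at x) = frechet_derivative (u n) (at x)"
      by (rule frechet_derivative_eq_on_open)
    then show ?thesis
      using True by simp
  next
    case False
    have "frechet_derivative (u n) (at x) v = 0"
    proof (rule frechet_derivative_eq_0_on_open)
      show "open (- S)" and "x \<in> - S"
        using \<open>closed S\<close> False by (auto simp: open_Compl)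
      fix y assume "y \<in> - S"
      then obtain h where "h \<in> F" "t h y < 0"
        unfolding S_eq t_def by auto
      then have "flat_exp 1 (real n * t h y - 1) = 0"
        using mult_nonneg_nonpos[of "real n" "t h y"] by (intro flat_exp_1_eq_0) linarith
      with \<open>h \<in> F\<close> show "u n y = 0"
        unfolding u_def using F(1) by auto
    qed
    with False show ?thesis by simp
  qed
  have zero: "(LINT x|lebesgue_on \<Omega>. g x * w n x) = 0" for n
  proof -
    have Cu: "C_k (Suc 0) (u n)"
      using u[of n] unfolding scalar_test_functions_def by blast
    obtain K where K: "compact K" "K \<subseteq> \<Omega>" "\<And>x. x \<notin> K \<Longrightarrow> u n x = 0"
        "\<And>x v. x \<notin> K \<Longrightarrow> frechet_derivative (u n) (at x) v = 0"
      using scalar_test_functionE[OF u] by metis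
    have "(LINT x|lebesgue_on \<Omega>. g x * w n x) =
        (LINT x|lebesgue_on \<Omega>. frechet_derivative (u n) (at x) v)"
      using weak[OF w[of n]] unfolding indicator_w by simp
    also have "\<dots> = (LINT x|lborel. frechet_derivative (u n) (at x) v)"
      using \<Omega> K(2,4)
      by (intro lebesgue_on_integral_eq_lborel borel_measurable_continuous_onI
          scalar_test_function_derivative_continuous[OF u]) auto
    also have "\<dots> = 0"
      by (rule integral_directional_derivative_eq_0[OF Cu K(1,3)])
    finally show ?thesis .
  qed
  obtain K where K: "compact K" "\<And>x. x \<notin> K \<Longrightarrow> \<psi> x = 0"
    using scalar_test_functionE[OF \<psi>] by metis
  have cont: "continuous_on UNIV f" if "f \<in> scalar_test_functions \<Omega>" for f
    using that C_k_continuous unfolding scalar_test_functions_def by blast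
  obtain B where B: "\<And>x. \<bar>\<psi> x\<bar> \<le> B"
    using continuous_compact_support_bounded[OF cont[OF \<psi>] K] by blast
  have meas: "f \<in> borel_measurable (lebesgue_on \<Omega>)" if "f \<in> scalar_test_functions \<Omega>" for f
    using cont[OF that] \<Omega>
    by (intro continuous_imp_measurable_on_sets_lebesgue) (auto intro: continuous_on_subset)
  have "(\<lambda>n. LINT x|lebesgue_on \<Omega>. g x * w n x) \<longlonglongrightarrow> (LINT x|lebesgue_on \<Omega>. g x * \<psi> x)"
  proof (rule integral_dominated_convergence)
    show "(\<lambda>x. g x * \<psi> x) \<in> borel_measurable (lebesgue_on \<Omega>)"
      using g meas[OF \<psi>] by auto
    show "(\<lambda>x. g x * w n x) \<in> borel_measurable (lebesgue_on \<Omega>)" for n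
      using g meas[OF w] by auto
    show "integrable (lebesgue_on \<Omega>) (\<lambda>x. \<bar>g x\<bar> * B)"
      using g by auto
    have "\<bar>w n x\<bar> \<le> B" for n x
    proof -
      have "\<bar>\<Prod>h\<in>F. avoid_zero n (t h x)\<bar> \<le> 1"
        by (simp add: abs_prod avoid_zero_bounds prod_le_1)
      then have "\<bar>w n x\<bar> \<le> \<bar>\<psi> x\<bar> * 1"
        unfolding w_def abs_mult by (intro mult_left_mono) auto
      with B[of x] show ?thesis by simp
    qed
    then show "AE x in lebesgue_on \<Omega>. norm (g x * w n x) \<le> \<bar>g x\<bar> * B" for n
      by (auto simp: abs_mult intro!: mult_left_mono)
    have "AE x in lebesgue_on \<Omega>. a h \<bullet> x \<noteq> b h" if "h \<in> F" for h
    proof -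
      have "{x. a h \<bullet> x = b h} \<in> null_sets lebesgue"
        using negligible_hyperplane[of "a h" "b h"] F(2) that
        by (simp add: negligible_iff_null_sets)
      then have "AE x in lebesgue. x \<notin> {x. a h \<bullet> x = b h}"
        by (rule AE_not_in)
      then show ?thesis
        using \<Omega> by (subst AE_restrict_space_iff) auto
    qed
    then have "AE x in lebesgue_on \<Omega>. \<forall>h\<in>F. a h \<bullet> x \<noteq> b h"
      using F(1) by (simp add: AE_finite_all)
    then show "AE x in lebesgue_on \<Omega>. (\<lambda>n. g x * w n x) \<longlonglongrightarrow> g x * \<psi> x"
    proof eventually_elim
      case (elim x)
      have "(\<lambda>n. w n x) \<longlonglongrightarrow> \<psi> x * (\<Prod>h\<in>F. 1)"
        unfolding w_def using elim
        by (intro tendsto_intros avoid_zero_tendsto_1) (auto simp: t_def)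
      from tendsto_mult_left[OF this, of "g x"] show ?case
        by simp
    qed
  qed
  then have "(LINT x|lebesgue_on \<Omega>. g x * \<psi> x) = 0"
    unfolding zero by (rule LIMSEQ_unique) (rule tendsto_const)
  with weak[OF \<psi>] show ?thesis
    by simp
qed

section \<open>Test functions that see the frontier of a convex set\<close>

text \<open>A radial bump around \<open>b\<close>, of radius \<open>sqrt r\<close> for \<open>r > 0\<close>; inside that ball its gradient points
  towards \<open>b\<close>.\<close>

lemma bump_derivative:
  fixes b :: "'a::euclidean_space"
  shows "((\<lambda>x. flat_exp 1 (r - (x - b) \<bullet> (x - b))) has_derivative
    (\<lambda>v. flat_exp [:0, 0, 1:] (r - (x - b) \<bullet> (x - b)) * (- 2 * ((x - b) \<bullet> v)))) (at x)"
proof -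
  have "((\<lambda>x. r - (x - b) \<bullet> (x - b)) has_derivative (\<lambda>v. - 2 * ((x - b) \<bullet> v))) (at x)"
    by (auto intro!: derivative_eq_intros simp: inner_commute)
  from has_derivative_compose[OF this flat_exp_has_derivative[of 1, unfolded has_field_derivative_def]]
  show ?thesis
    by simp
qed

lemma C_k_bump:
  fixes b :: "'a::euclidean_space"
  shows "C_k k (\<lambda>x. flat_exp p (r - (x - b) \<bullet> (x - b)))"
proof -
  have "C_k j (\<lambda>x. r - (x - b) \<bullet> (x - b))" for j
  proof (rule C_k_antimono, rule C_k_SucI)
    show "((\<lambda>x. r - (x - b) \<bullet> (x - b)) has_derivative (\<lambda>v. - 2 * ((x - b) \<bullet> v))) (at x)" for x
      by (auto intro!: derivative_eq_intros simp: inner_commute)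
    fix v
    have "C_k j (\<lambda>x. x \<bullet> (- 2 *\<^sub>R v) + 2 * (b \<bullet> v))"
      by (intro C_k_add C_k_const C_k_bounded_linear bounded_linear_inner_left)
    then show "C_k j (\<lambda>x. - 2 * ((x - b) \<bullet> v))"
      by (simp add: inner_diff_left algebra_simps)
  qed
  then show ?thesis
    by (rule C_k_compose_real[OF C_k_flat_exp])
qed

text \<open>The derivative of a test function has compact support inside \<open>\<Omega>\<close>, which is why integrals over \<open>\<Omega>\<close>
  can be exchanged with integrals over the whole space.\<close>

lemma indicator_derivative_integrable:
  fixes \<Omega> S :: "'a::euclidean_space set"
  assumes "open \<Omega>" and "closed S" and \<psi>: "\<psi> \<in> scalar_test_functions \<Omega>"
  shows "integrable lborel (\<lambda>x. indicator S x * frechet_derivative \<psi> (at x) v)" (is ?lborel)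
    and "integrable (lebesgue_on \<Omega>) (\<lambda>x. indicator S x * frechet_derivative \<psi> (at x) v)" (is ?\<Omega>)
    and "(LINT x|lebesgue_on \<Omega>. indicator S x * frechet_derivative \<psi> (at x) v) =
      (LINT x|lborel. indicator S x * frechet_derivative \<psi> (at x) v)" (is ?eq)
proof -
  let ?D = "\<lambda>x. frechet_derivative \<psi> (at x) v"
  obtain K where K: "compact K" "K \<subseteq> \<Omega>" "\<And>x. x \<notin> K \<Longrightarrow> ?D x = 0"
    using scalar_test_functionE[OF \<psi>] by metis
  have "integrable lborel ?D"
    by (rule continuous_compact_support_integrable[OF
          scalar_test_function_derivative_continuous[OF \<psi>] K(1,3)])
  then show l: ?lborel
    using integrable_mult_indicator[of S lborel ?D] \<open>closed S\<close> by simp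
  then have "integrable lebesgue (\<lambda>x. indicator S x * ?D x)"
    by (simp add: integrable_completion)
  from integrable_mult_indicator[OF _ this, of \<Omega>]
  have "integrable lebesgue (\<lambda>x. indicator \<Omega> x *\<^sub>R (indicator S x * ?D x))"
    using \<open>open \<Omega>\<close> by simp
  then show ?\<Omega>
    using \<open>open \<Omega>\<close> by (subst integrable_restrict_space) auto
  show ?eq
  proof (rule lebesgue_on_integral_eq_lborel[OF \<open>open \<Omega>\<close>])
    show "(\<lambda>x. indicator S x * ?D x) \<in> borel_measurable borel"
      using borel_measurable_integrable[OF l] by simp
    show "indicator S x * ?D x = 0" if "x \<notin> \<Omega>" for x
      using subsetD[OF K(2), of x] K(3)[of x] that by auto
  qed
qed

text \<open>Take a point \<open>b\<close> outside the convex set but close to \<open>x0\<close>, and a radial bump around \<open>b\<close> that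
  reaches \<open>x0\<close>. A hyperplane separates \<open>b\<close> from \<open>S\<close>. The bump increases towards \<open>b\<close>, hence its
  derivative along the normal of this hyperplane has a constant sign on \<open>S\<close>, and it is nonzero on an
  open piece of \<open>S\<close>: the integral cannot cancel.\<close>

lemma convex_frontier_detected_by_test_function:
  fixes \<Omega> S :: "'a::euclidean_space set"
  assumes "open \<Omega>" and "closed S" and "convex S" and "interior S \<noteq> {}"
    and "x0 \<in> \<Omega>" and "x0 \<in> frontier S"
  obtains \<psi> v where "\<psi> \<in> scalar_test_functions \<Omega>"
    and "(LINT x|lebesgue_on \<Omega>. indicator S x * frechet_derivative \<psi> (at x) v) \<noteq> 0"
proof -
  \<comment> \<open>The bump has radius \<open>r\<close> and its centre has distance less than \<open>r\<close> from \<open>x0\<close>, so twice \<open>r\<close> must fit.\<close>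
  obtain r where r: "r > 0" "cball x0 (2 * r) \<subseteq> \<Omega>"
  proof -
    obtain e where "e > 0" "cball x0 e \<subseteq> \<Omega>"
      using assms(1,5) open_contains_cball by blast
    then show thesis
      by (intro that[of "e / 2"]) auto
  qed
  obtain b where b: "b \<notin> S" "dist x0 b < r"
    using assms(6) r(1) unfolding frontier_straddle by blast
  obtain c d where cd: "c \<bullet> b < d" "\<And>x. x \<in> S \<Longrightarrow> d < c \<bullet> x"
    using separating_hyperplane_closed_point[OF \<open>convex S\<close> \<open>closed S\<close> b(1)] by blast
  define \<psi> where "\<psi> x = flat_exp 1 (r\<^sup>2 - (x - b) \<bullet> (x - b))" for x
  have sub: "{x. \<psi> x \<noteq> 0} \<subseteq> cball b r"
  proof
    fix x assume "x \<in> {x. \<psi> x \<noteq> 0}"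
    then have "(norm (x - b))\<^sup>2 < r\<^sup>2"
      using flat_exp_1_eq_0[of "r\<^sup>2 - (x - b) \<bullet> (x - b)"]
      unfolding \<psi>_def power2_norm_eq_inner by force
    then have "norm (x - b) < r"
      using r(1) power2_less_imp_less by fastforce
    then show "x \<in> cball b r"
      by (simp add: dist_norm norm_minus_commute)
  qed
  have "closure {x. \<psi> x \<noteq> 0} \<subseteq> cball b r"
    by (rule closure_minimal[OF sub closed_cball])
  moreover have "cball b r \<subseteq> cball x0 (2 * r)"
  proof
    fix x assume "x \<in> cball b r"
    then show "x \<in> cball x0 (2 * r)"
      using b(2) dist_triangle[of x0 x b] by simp
  qed
  moreover have "compact (closure {x. \<psi> x \<noteq> 0})"
    using sub bounded_subset[OF bounded_cball] by (simp add: compact_closure)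
  moreover have "C_k k \<psi>" for k
    unfolding \<psi>_def[abs_def] by (rule C_k_bump)
  ultimately have \<psi>: "\<psi> \<in> scalar_test_functions \<Omega>"
    using r(2) unfolding scalar_test_functions_def by blast
  \<comment> \<open>The separation inequality reads \<open>c \<bullet> b < c \<bullet> x\<close> on \<open>S\<close>, so \<open>- c\<close> points from \<open>S\<close> towards \<open>b\<close>.\<close>
  let ?f = "\<lambda>x. indicator S x * frechet_derivative \<psi> (at x) (- c)"
  have D: "frechet_derivative \<psi> (at x) (- c) =
      flat_exp [:0, 0, 1:] (r\<^sup>2 - (x - b) \<bullet> (x - b)) * (2 * (c \<bullet> x - c \<bullet> b))" for x
  proof -
    have "frechet_derivative \<psi> (at x) = (\<lambda>v. flat_exp [:0, 0, 1:] (r\<^sup>2 - (x - b) \<bullet> (x - b)) * (- 2 * ((x - b) \<bullet> v)))"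
      using frechet_derivative_at[OF bump_derivative[of "r\<^sup>2" b x]] unfolding \<psi>_def[abs_def] ..
    moreover have "(x - b) \<bullet> (- c) = - (c \<bullet> x - c \<bullet> b)"
      by (simp add: inner_diff_right inner_commute)
    ultimately show ?thesis
      by (simp add: right_diff_distrib)
  qed
  have f_nonneg: "0 \<le> ?f x" for x
    unfolding D using cd(1) cd(2)[of x] by (auto simp: indicator_def flat_exp_def)
  define W where "W = interior S \<inter> ball b r"
  have f_pos: "0 < ?f x" if "x \<in> W" for x
  proof -
    have "x \<in> S" and "norm (x - b) < r"
      using that interior_subset unfolding W_def by (auto simp: dist_norm norm_minus_commute)
    then have "(x - b) \<bullet> (x - b) < r\<^sup>2"
      unfolding power2_norm_eq_inner[symmetric] by (intro power_strict_mono) auto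
    then show ?thesis
      unfolding D using cd(1) cd(2)[OF \<open>x \<in> S\<close>] \<open>x \<in> S\<close> by (simp add: flat_exp_def)
  qed
  have "x0 \<in> closure (interior S)"
    using assms(2-4,6) by (simp add: convex_closure_interior frontier_def)
  moreover have "x0 \<in> ball b r"
    using b(2) by (simp add: dist_commute)
  ultimately have "W \<noteq> {}"
    unfolding W_def using open_Int_closure_eq_empty[OF open_ball, of b r "interior S"] by blast
  have "open W"
    unfolding W_def by auto
  have "(LINT x|lborel. ?f x) \<noteq> 0"
  proof
    assume "(LINT x|lborel. ?f x) = 0"
    then have "AE x in lborel. ?f x = 0"
      using f_nonneg integral_nonneg_eq_0_iff_AE[OF indicator_derivative_integrable(1)[OF assms(1,2) \<psi>]]
      by simp
    then have "AE x in lborel. x \<notin> W"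
      by eventually_elim (use f_pos in force)
    then have "W \<in> null_sets lborel"
      using \<open>open W\<close> by (simp add: AE_iff_null_sets)
    then have "negligible W"
      by (simp add: negligible_iff_null_sets null_sets_completionI)
    then show False
      using \<open>open W\<close> \<open>W \<noteq> {}\<close> open_not_negligible by blast
  qed
  then show thesis
    using that[OF \<psi>] indicator_derivative_integrable(3)[OF assms(1,2) \<psi>] by simp
qed

section \<open>Piecewise multiples of the identity in the finite element space\<close>

lemma bform_scaled_identity: "bform u (c *\<^sub>R mat 1) v = c * (u \<bullet> v)"
  by (simp add: bform_def scaleR_matrix_vector_assoc[symmetric])

lemma inner_cross_swap: "u \<bullet> cross3 n v + v \<bullet> cross3 n u = 0"
  by (simp add: cross3_simps)

lemma inner_cross_swap_scaled: "c * (u \<bullet> cross3 n v) + c * (v \<bullet> cross3 n u) = 0"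
  using inner_cross_swap[of u n v] by (simp flip: distrib_left)

text \<open>The symmetric Curl of \<open>f I\<close> vanishes, because \<open>Curl (f I)\<close> is the skew-symmetric matrix
  associated with \<open>\<nabla>f\<close>. In terms of the interelement conditions: those at
  vertices are off-diagonal entries and differences of diagonal ones; the others pair the matrix with
  two orthogonal vectors, or symmetrize the form \<open>u \<bullet> (n \<times> v)\<close>, which is antisymmetric in
  \<open>u\<close> and \<open>v\<close> when the matrix is the identity.\<close>

lemma scaled_identities_same:
  shows "same_at_vertex (c *\<^sub>R mat 1) (d *\<^sub>R mat 1)"
    and "n1 \<bullet> t = 0 \<Longrightarrow> n2 \<bullet> t = 0 \<Longrightarrow> same_at_edge t n1 n2 (c *\<^sub>R mat 1) (d *\<^sub>R mat 1)"
    and "same_at_edge_in_face t n (c *\<^sub>R mat 1) (d *\<^sub>R mat 1)"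
    and "same_at_face n a1 a2 (c *\<^sub>R mat 1) (d *\<^sub>R mat 1)"
  by (simp add: same_at_vertex_def mat_def)
    (simp_all add: same_at_edge_def same_at_edge_in_face_def
      same_at_face_def Let_def bform_scaled_identity dot_cross_self inner_cross_swap_scaled)

lemma scaled_identities_compatible:
  assumes "grid_frame \<T> \<F>"
  shows "symCurl_compatible k \<T> \<F> (\<lambda>T x. c T *\<^sub>R mat 1)"
proof -
  have "edge_normal1 \<F> E \<bullet> edge_tangent \<F> E = 0 \<and> edge_normal2 \<F> E \<bullet> edge_tangent \<F> E = 0"
    if "T \<in> \<T>" "E edge_of T" for T E
  proof -
    have "span {edge_normal1 \<F> E, edge_normal2 \<F> E} = {v. orthogonal v (edge_tangent \<F> E)}"
      using assms that unfolding grid_frame_def Let_def by blast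
    then show ?thesis
      using span_base[of _ "{edge_normal1 \<F> E, edge_normal2 \<F> E}"]
      by (auto simp: orthogonal_def)
  qed
  then show ?thesis
    unfolding symCurl_compatible_def by (auto intro!: scaled_identities_same)
qed

lemma constant_in_matrix_polys: "(\<lambda>x. M) \<in> matrix_polys k"
proof -
  define c :: "(3 \<Rightarrow> nat) \<Rightarrow> real^3^3" where "c \<alpha> = (if \<alpha> = (\<lambda>_. 0) then M else 0)" for \<alpha>
  let ?A = "{\<alpha> :: 3 \<Rightarrow> nat. (\<Sum>i\<in>UNIV. \<alpha> i) \<le> k}"
  have "?A \<subseteq> UNIV \<rightarrow>\<^sub>E {..k}"
  proof
    fix \<alpha> :: "3 \<Rightarrow> nat" assume "\<alpha> \<in> ?A"
    then have "\<alpha> i \<le> k" for i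
      using member_le_sum[of i UNIV \<alpha>] by simp
    then show "\<alpha> \<in> UNIV \<rightarrow>\<^sub>E {..k}"
      by auto
  qed
  then have "finite ?A"
    by (rule finite_subset) (intro finite_PiE finite finite_atMost)
  have "M = (\<Sum>\<alpha>\<in>?A. (\<Prod>i\<in>UNIV. (x $ i) ^ \<alpha> i) *\<^sub>R c \<alpha>)" for x :: "real^3"
  proof -
    have "(\<Sum>\<alpha>\<in>?A. (\<Prod>i\<in>UNIV. (x $ i) ^ \<alpha> i) *\<^sub>R c \<alpha>) =
        (\<Sum>\<alpha>\<in>{\<lambda>_. 0}. (\<Prod>i\<in>UNIV. (x $ i) ^ \<alpha> i) *\<^sub>R c \<alpha>)"
      by (rule sum.mono_neutral_right) (use \<open>finite ?A\<close> in \<open>auto simp: c_def\<close>)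
    then show ?thesis
      by (simp add: c_def)
  qed
  then show ?thesis
    unfolding matrix_polys_def by blast
qed

lemma simplex_3_properties:
  fixes T :: "(real^3) set"
  assumes "3 simplex T"
  shows "polyhedron T" and "closed T" and "convex T" and "interior T \<noteq> {}" and "aff_dim T = 3"
proof -
  have "polytope T"
    using assms simplex_imp_polytope by blast
  then show "polyhedron T" and "closed T" and "convex T"
    by (auto simp: polytope_imp_polyhedron polytope_imp_closed polytope_imp_convex)
  show dim: "aff_dim T = 3"
    using assms by (rule aff_dim_simplex)
  then have "affine hull T = UNIV"
    by (simp add: aff_dim_eq_full[symmetric])
  then have "rel_interior T = interior T"
    by (rule rel_interior_interior)
  moreover have "rel_interior T \<noteq> {}"
    using \<open>convex T\<close> dim by (auto simp: rel_interior_eq_empty)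
  ultimately show "interior T \<noteq> {}"
    by simp
qed

text \<open>The intersection is a face of \<open>S\<close>. It is a proper face, for otherwise \<open>S\<close> would be a proper face of
  \<open>T\<close> of the same dimension; hence it lies in the frontier of a convex set.\<close>

lemma grid_overlap_negligible:
  assumes "conforming_tetrahedral_grid \<T> \<Omega>" and "S \<in> \<T>" and "T \<in> \<T>" and "S \<noteq> T"
  shows "negligible (S \<inter> T)"
proof -
  have ST: "(S \<inter> T) face_of S" "(S \<inter> T) face_of T" "3 simplex S" "3 simplex T"
    using assms unfolding conforming_tetrahedral_grid_def triangulation_def
    by (blast, metis Int_commute, blast+)
  note S = simplex_3_properties[OF ST(3)] and T = simplex_3_properties[OF ST(4)]
  have "S \<inter> T \<noteq> S"
  proof
    assume "S \<inter> T = S"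
    then have "aff_dim S < aff_dim T"
      using ST(2) T(3) \<open>S \<noteq> T\<close> by (metis face_of_aff_dim_lt)
    then show False
      using S(5) T(5) by simp
  qed
  then have "S \<inter> T \<subseteq> rel_frontier S"
    using ST(1) by (rule face_of_subset_rel_frontier[rotated])
  also have "\<dots> \<subseteq> frontier S"
    using interior_subset_rel_interior[of S] unfolding rel_frontier_def frontier_def by blast
  finally show ?thesis
    using negligible_convex_frontier[OF S(3)] negligible_subset by blast
qed

lemma finite_measure_bounded_open:
  assumes "open \<Omega>" and "bounded \<Omega>"
  shows "finite_measure (lebesgue_on \<Omega>)"
  using assms by (intro finite_measure_lebesgue_on lmeasurable_open)

lemma indicator_constant_in_Lp_space:
  assumes "open \<Omega>" and "bounded \<Omega>" and "closed T"
  shows "(\<lambda>x. indicator T x *\<^sub>R M) \<in> Lp_space q \<Omega>"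
proof -
  interpret finite_measure "lebesgue_on \<Omega>"
    by (rule finite_measure_bounded_open[OF assms(1,2)])
  have "(indicator T :: real^3 \<Rightarrow> real) \<in> borel_measurable (lebesgue_on \<Omega>)"
    using assms(3) by (intro measurable_restrict_space1 borel_measurable_indicator) auto
  then have m: "(\<lambda>x. indicator T x *\<^sub>R M) \<in> borel_measurable (lebesgue_on \<Omega>)"
    by auto
  moreover have "integrable (lebesgue_on \<Omega>) (\<lambda>x. norm (indicator T x *\<^sub>R M) powr q)"
  proof (rule integrable_const_bound[where B="norm M powr q"])
    show "(\<lambda>x. norm (indicator T x *\<^sub>R M) powr q) \<in> borel_measurable (lebesgue_on \<Omega>)"
      using m by measurable
  qed (auto simp: indicator_def)
  ultimately show ?thesis
    unfolding Lp_space_def by blast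
qed

lemma grid_element_indicator_in_V_symCurl:
  assumes grid: "conforming_tetrahedral_grid \<T> \<Omega>" and "grid_frame \<T> \<F>"
    and "open \<Omega>" and "bounded \<Omega>" and "T \<in> \<T>"
  shows "(\<lambda>x. indicator T x *\<^sub>R mat 1) \<in> V_symCurl k \<T> \<F> \<Omega>"
proof -
  have simplex: "3 simplex S" if "S \<in> \<T>" for S
    using grid that unfolding conforming_tetrahedral_grid_def by blast
  define c :: "(real^3) set \<Rightarrow> real" where "c S = (if S = T then 1 else 0)" for S
  have "AE x in lebesgue_on S. indicator T x *\<^sub>R mat 1 = c S *\<^sub>R (mat 1 :: real^3^3)" if "S \<in> \<T>" for S
  proof (cases "S = T")
    case True
    then show ?thesis
      by (intro AE_I2) (simp add: c_def)
  next
    case False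
    have "S \<in> sets lebesgue"
      using simplex_3_properties(2)[OF simplex[OF that]] by (simp add: borel_closed)
    have "AE x in lebesgue. x \<notin> S \<inter> T"
      using grid_overlap_negligible[OF grid that \<open>T \<in> \<T>\<close> False]
      by (intro AE_not_in) (simp add: negligible_iff_null_sets)
    then show ?thesis
      using \<open>S \<in> sets lebesgue\<close> False by (subst AE_restrict_space_iff) (auto simp: c_def)
  qed
  moreover have "(\<lambda>x. indicator T x *\<^sub>R mat 1 :: real^3^3) \<in> Lp_space 2 \<Omega>"
    using assms simplex simplex_3_properties(2) by (intro indicator_constant_in_Lp_space) auto
  ultimately show ?thesis
    unfolding V_symCurl_def
    using scaled_identities_compatible[OF assms(2), of k c] constant_in_matrix_polys
    by (intro CollectI conjI exI[of _ "\<lambda>T x. c T *\<^sub>R mat 1"] ballI) auto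
qed

text \<open>With two elements the domain meets \<open>T\<close> and is not contained in \<open>T\<close>, so a connected domain
  must cross the frontier of \<open>T\<close>.\<close>

lemma grid_element_frontier_meets_domain:
  assumes grid: "conforming_tetrahedral_grid \<T> \<Omega>" and "connected \<Omega>" and "card \<T> > 1"
  obtains T x where "T \<in> \<T>" and "x \<in> \<Omega>" and "x \<in> frontier T"
proof -
  obtain S T where ST: "S \<in> \<T>" "T \<in> \<T>" "S \<noteq> T"
    using \<open>card \<T> > 1\<close> by (metis One_nat_def card_le_Suc0_iff_eq card.infinite not_less not_less_zero)
  have sub: "interior R \<noteq> {} \<and> interior R \<subseteq> \<Omega>" if "R \<in> \<T>" for R
    using grid that simplex_3_properties(4) interior_mono[of R "\<Union>\<T>"]
    unfolding conforming_tetrahedral_grid_def by blast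
  have "\<Omega> \<inter> T \<noteq> {}"
    using sub[OF ST(2)] interior_subset by blast
  moreover have "\<not> interior S \<subseteq> T"
  proof
    assume "interior S \<subseteq> T"
    then have "interior S \<subseteq> S \<inter> T"
      using interior_subset by blast
    then have "negligible (interior S)"
      using grid_overlap_negligible[OF grid ST] negligible_subset by blast
    then show False
      using sub[OF ST(1)] open_not_negligible by blast
  qed
  then have "\<Omega> - T \<noteq> {}"
    using sub[OF ST(1)] by blast
  ultimately have "\<Omega> \<inter> frontier T \<noteq> {}"
    by (rule connected_Int_frontier[OF \<open>connected \<Omega>\<close>])
  then show thesis
    using that ST(2) by blast
qed

section \<open>The distributional Curl of an indicator times the identity\<close>

lemma scaled_vector_test_function:
  assumes "\<psi> \<in> scalar_test_functions \<Omega>" and "e \<noteq> 0"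
  shows "(\<lambda>x. \<psi> x *\<^sub>R e) \<in> test_functions \<Omega>"
  using assms by (auto simp: scalar_test_functions_def test_functions_def intro!: C_k_scaleR C_k_const)

lemma pderiv3_scaled_axis:
  assumes "\<psi> \<in> scalar_test_functions \<Omega>"
  shows "pderiv3 j i (\<lambda>x. \<psi> x *\<^sub>R axis m 1) x =
    (if i = m then frechet_derivative \<psi> (at x) (axis j 1) else 0)"
proof -
  have "C_k (Suc 0) \<psi>"
    using assms unfolding scalar_test_functions_def by blast
  then have "((\<lambda>x. \<psi> x *\<^sub>R (axis m 1 :: real^3)) has_derivative
      (\<lambda>v. frechet_derivative \<psi> (at x) v *\<^sub>R axis m 1)) (at x)"
    by (intro has_derivative_scaleR_left C_k_Suc_has_derivative)
  from frechet_derivative_at[OF this, symmetric] show ?thesis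
    unfolding pderiv3_def by (simp add: axis_def)
qed

text \<open>Testing the \<open>i\<close>-th row with \<open>\<psi>\<close> times the \<open>m\<close>-th unit vector picks out one entry of \<open>Q\<close> on one
  side, and the \<open>i\<close>-th component of a curl, a single partial derivative of \<open>\<psi>\<close>, on the other.\<close>

lemma weak_Curl_component:
  assumes "is_weak_Curl \<Omega> (\<lambda>x. indicator T x *\<^sub>R mat 1) Q" and "\<psi> \<in> scalar_test_functions \<Omega>"
  shows "(LINT x|lebesgue_on \<Omega>. indicator T x * curl (\<lambda>x. \<psi> x *\<^sub>R axis m 1) x $ i) =
    (LINT x|lebesgue_on \<Omega>. Q x $ i $ m * \<psi> x)"
proof -
  have "(mat 1 :: real^3^3) $ i = axis i 1"
    by (simp add: mat_def axis_def vec_eq_iff)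
  then have "((indicator T x *\<^sub>R mat 1 :: real^3^3) $ i) \<bullet> w = indicator T x * w $ i" for x and w :: "real^3"
    by (simp add: inner_axis')
  moreover have "(Q x $ i) \<bullet> (\<psi> x *\<^sub>R axis m 1) = Q x $ i $ m * \<psi> x" for x
    by (simp add: inner_axis)
  moreover have "(\<lambda>x. \<psi> x *\<^sub>R axis m 1) \<in> test_functions \<Omega>"
    by (rule scaled_vector_test_function[OF assms(2)]) simp
  ultimately show ?thesis
    using assms(1) unfolding is_weak_Curl_def by (metis (no_types, lifting) Bochner_Integration.integral_cong)
qed

text \<open>Off-diagonal entries of the Curl of \<open>f I\<close> are the partial derivatives of \<open>f\<close> up to sign, and every
  partial derivative occurs. So a Curl of the indicator times the identity contains the full weak
  gradient of the indicator.\<close>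

lemma weak_Curl_gives_weak_derivative:
  fixes j :: 3
  assumes "is_weak_Curl \<Omega> (\<lambda>x. indicator T x *\<^sub>R mat 1) Q"
  obtains i m :: 3 and c :: real where "\<And>\<psi>. \<psi> \<in> scalar_test_functions \<Omega> \<Longrightarrow>
    (LINT x|lebesgue_on \<Omega>. indicator T x * frechet_derivative \<psi> (at x) (axis j 1)) =
    (LINT x|lebesgue_on \<Omega>. (c * Q x $ i $ m) * \<psi> x)"
proof -
  have curl: "curl (\<lambda>x. \<psi> x *\<^sub>R axis 3 1) x $ 2 = - frechet_derivative \<psi> (at x) (axis 1 1)"
    "curl (\<lambda>x. \<psi> x *\<^sub>R axis 3 1) x $ 1 = frechet_derivative \<psi> (at x) (axis 2 1)"
    "curl (\<lambda>x. \<psi> x *\<^sub>R axis 2 1) x $ 1 = - frechet_derivative \<psi> (at x) (axis 3 1)"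
    if "\<psi> \<in> scalar_test_functions \<Omega>" for \<psi> x
    using that by (simp_all add: curl_def pderiv3_scaled_axis)
  consider "j = 1" | "j = 2" | "j = 3"
    using exhaust_3 by blast
  then show thesis
  proof cases
    case 1
    show thesis
      by (rule that[of "-1" 2 3])
        (use weak_Curl_component[OF assms, of _ 3 2, symmetric] in \<open>simp add: 1 curl\<close>)
  next
    case 2
    show thesis
      by (rule that[of 1 1 3])
        (use weak_Curl_component[OF assms, of _ 3 1, symmetric] in \<open>simp add: 2 curl\<close>)
  next
    case 3
    show thesis
      by (rule that[of "-1" 1 2])
        (use weak_Curl_component[OF assms, of _ 2 1, symmetric] in \<open>simp add: 3 curl\<close>)
  qed
qed

text \<open>On a set of finite measure integrability of the \<open>p\<close>-th power implies integrability, as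
  \<open>y \<le> 1 + y\<^sup>p\<close> for \<open>y \<ge> 0\<close> and \<open>p \<ge> 1\<close>.\<close>

lemma Lp_space_component_integrable:
  fixes Q :: "real^3 \<Rightarrow> real^3^3" and i m :: 3
  assumes "open \<Omega>" and "bounded \<Omega>" and "p \<ge> 1" and "Q \<in> Lp_space p \<Omega>"
  shows "integrable (lebesgue_on \<Omega>) (\<lambda>x. Q x $ i $ m)"
proof -
  interpret finite_measure "lebesgue_on \<Omega>"
    by (rule finite_measure_bounded_open[OF assms(1,2)])
  have Q: "Q \<in> borel_measurable (lebesgue_on \<Omega>)"
    "integrable (lebesgue_on \<Omega>) (\<lambda>x. norm (Q x) powr p)"
    using assms(4) unfolding Lp_space_def by auto
  show ?thesis
  proof (rule Bochner_Integration.integrable_bound)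
    show "integrable (lebesgue_on \<Omega>) (\<lambda>x. 1 + norm (Q x) powr p)"
      using Q(2) by auto
    have "bounded_linear (\<lambda>M :: real^3^3. M $ i $ m)"
      by (intro bounded_linear_compose[OF bounded_linear_vec_nth bounded_linear_vec_nth])
    then show "(\<lambda>x. Q x $ i $ m) \<in> borel_measurable (lebesgue_on \<Omega>)"
      by (intro measurable_compose[OF Q(1)] borel_measurable_continuous_onI linear_continuous_on)
    have "\<bar>M $ i $ m\<bar> \<le> 1 + norm M powr p" for M :: "real^3^3"
    proof -
      have "\<bar>M $ i $ m\<bar> \<le> norm M"
        using component_le_norm_cart[of "M $ i" m] Finite_Cartesian_Product.norm_nth_le[of M i] by linarith
      also have "norm M \<le> 1 + norm M powr p"
      proof (cases "norm M \<le> 1")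
        case False
        then have "norm M powr 1 \<le> norm M powr p"
          using \<open>p \<ge> 1\<close> by (intro powr_mono) auto
        with False show ?thesis by simp
      qed (use powr_ge_zero[of "norm M" p] in linarith)
      finally show ?thesis .
    qed
    then show "AE x in lebesgue_on \<Omega>. norm (Q x $ i $ m) \<le> norm (1 + norm (Q x) powr p)"
      by (intro AE_I2) (simp add: order_trans[OF _ abs_ge_self])
  qed
qed

text \<open>A Curl in \<open>L\<^sup>p\<close> would give the indicator an integrable weak gradient. For a polyhedron this gradient
  must vanish, which contradicts the test function that sees the frontier inside \<open>\<Omega>\<close>.\<close>

lemma indicator_identity_not_in_H_Curl:
  assumes "open \<Omega>" and "bounded \<Omega>" and "p \<ge> 1" and "polyhedron T" and "interior T \<noteq> {}"
    and "x0 \<in> \<Omega>" and "x0 \<in> frontier T"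
  shows "(\<lambda>x. indicator T x *\<^sub>R mat 1) \<notin> H_Curl p \<Omega>"
proof
  have T: "closed T" "convex T"
    using assms(4) polyhedron_imp_closed polyhedron_imp_convex by auto
  assume "(\<lambda>x. indicator T x *\<^sub>R mat 1) \<in> H_Curl p \<Omega>"
  then obtain Q where Q: "Q \<in> Lp_space p \<Omega>" "is_weak_Curl \<Omega> (\<lambda>x. indicator T x *\<^sub>R mat 1) Q"
    unfolding H_Curl_def by blast
  have zero: "(LINT x|lebesgue_on \<Omega>. indicator T x * frechet_derivative \<psi> (at x) (axis j 1)) = 0"
    if \<psi>: "\<psi> \<in> scalar_test_functions \<Omega>" for \<psi> and j :: 3
  proof -
    obtain i m c where weak: "\<And>\<psi>. \<psi> \<in> scalar_test_functions \<Omega> \<Longrightarrow>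
      (LINT x|lebesgue_on \<Omega>. indicator T x * frechet_derivative \<psi> (at x) (axis j 1)) =
      (LINT x|lebesgue_on \<Omega>. (c * Q x $ i $ m) * \<psi> x)"
      by (rule weak_Curl_gives_weak_derivative[OF Q(2), where j=j]) (rule that)
    have "integrable (lebesgue_on \<Omega>) (\<lambda>x. c * Q x $ i $ m)"
      using Lp_space_component_integrable[OF assms(1-3) Q(1)] by simp
    from polyhedron_weak_derivative_eq_0[OF assms(4,1) this weak \<psi>] show ?thesis .
  qed
  obtain \<psi> v where \<psi>: "\<psi> \<in> scalar_test_functions \<Omega>"
    and nz: "(LINT x|lebesgue_on \<Omega>. indicator T x * frechet_derivative \<psi> (at x) v) \<noteq> 0"
    by (rule convex_frontier_detected_by_test_function[OF assms(1) T assms(5-7)])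
  have "frechet_derivative \<psi> (at x) v = (\<Sum>j\<in>UNIV. v $ j * frechet_derivative \<psi> (at x) (axis j 1))" for x
  proof -
    have "C_k (Suc 0) \<psi>"
      using \<psi> unfolding scalar_test_functions_def by blast
    then have lin: "linear (frechet_derivative \<psi> (at x))"
      by (rule has_derivative_linear[OF C_k_Suc_has_derivative])
    have "frechet_derivative \<psi> (at x) (\<Sum>j\<in>UNIV. v $ j *\<^sub>R axis j 1) =
        (\<Sum>j\<in>UNIV. v $ j * frechet_derivative \<psi> (at x) (axis j 1))"
      by (simp add: linear_sum[OF lin] linear_scale[OF lin])
    moreover have "(\<Sum>j\<in>UNIV. v $ j *\<^sub>R axis j 1) = v"
      using basis_expansion[of v] by (simp add: scalar_mult_eq_scaleR)
    ultimately show ?thesis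
      by simp
  qed
  then have "(LINT x|lebesgue_on \<Omega>. indicator T x * frechet_derivative \<psi> (at x) v) =
      (LINT x|lebesgue_on \<Omega>. (\<Sum>j\<in>UNIV. v $ j * (indicator T x * frechet_derivative \<psi> (at x) (axis j 1))))"
    by (simp add: sum_distrib_left mult.left_commute)
  also have "\<dots> = (\<Sum>j\<in>UNIV. v $ j * (LINT x|lebesgue_on \<Omega>. indicator T x * frechet_derivative \<psi> (at x) (axis j 1)))"
    using indicator_derivative_integrable(2)[OF assms(1) T(1) \<psi>] by simp
  also have "\<dots> = 0"
    using zero[OF \<psi>] by simp
  finally show False
    using nz by simp
qed

theorem theorem13:
  fixes \<Omega> :: "(real^3) set" and \<T> :: "(real^3) set set" and \<F> :: frame
    and p :: real and k :: nat
  assumes "\<Omega> \<noteq> {}" and "open \<Omega>" and "connected \<Omega>" and "bounded \<Omega>"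
    and "p \<ge> 1" and "k \<ge> 1"
    and "conforming_tetrahedral_grid \<T> \<Omega>"
    and "connected (\<Union>\<T>)"
    and "card \<T> > 1"
    and "grid_frame \<T> \<F>"
  shows "\<exists>U\<^sub>h \<in> V_symCurl k \<T> \<F> \<Omega>. U\<^sub>h \<notin> H_Curl p \<Omega>"
proof -
  obtain T x where T: "T \<in> \<T>" "x \<in> \<Omega>" "x \<in> frontier T"
    by (rule grid_element_frontier_meets_domain[OF assms(7,3,9)])
  have "3 simplex T"
    using assms(7) T(1) unfolding conforming_tetrahedral_grid_def by blast
  then have "(\<lambda>x. indicator T x *\<^sub>R mat 1) \<notin> H_Curl p \<Omega>"
    using simplex_3_properties T by (intro indicator_identity_not_in_H_Curl[OF assms(2,4,5)]) auto
  moreover have "(\<lambda>x. indicator T x *\<^sub>R mat 1) \<in> V_symCurl k \<T> \<F> \<Omega>"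
    by (rule grid_element_indicator_in_V_symCurl[OF assms(7,10,2,4) T(1)])
  ultimately show ?thesis
    by blast
qed

end
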